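(* Let $\mathcal L$ be one of the logics $EL5^-$, $EL5$, $EkL5^-$, $EkL5$ with $k\in\{4,5,6\}$. Then for every set of formulas $\Phi\cup\{\varphi\}$: if $\Phi\vdash_{\mathcal L}\varphi$ then $\Phi\Vdash^r_{\mathcal L}\varphi$.
   Context: Syntax. Formulas $Fm$ are built from an infinite set $V$ of variables using $\bot,\wedge,\vee,\rightarrow$ and unary $\square,K$; $\neg\varphi:=\varphi\rightarrow\bot$. Axiom schemes: (INT) all theorems of intuitionistic propositional logic and their substitution-instances; (A1) $\square(\varphi\vee\psi)\rightarrow(\square\varphi\vee\square\psi)$; (A2) $\square\varphi\rightarrow\varphi$; (A3) $\square(\varphi\rightarrow\psi)\rightarrow\square(\square\varphi\rightarrow\square\psi)$; (A4) $\square\varphi\rightarrow\square\square\varphi$; (A5) $\neg\square\varphi\rightarrow\square\neg\square\varphi$; (KBel) $K(\varphi\rightarrow\psi)\rightarrow(K\varphi\rightarrow K\psi)$; (CoRe) $\square\varphi\rightarrow\square K\varphi$; (IntRe) $K\varphi\rightarrow\neg\neg\varphi$; (E4) $K\varphi\rightarrow KK\varphi$; (E5) $\neg K\varphi\rightarrow K\neg K\varphi$; (PNB) $K\varphi\rightarrow\square K\varphi$; (NNB) $\neg K\varphi\rightarrow\square\neg K\varphi$. Theorem scheme (TND) $\varphi\vee\neg\varphi$. Rules MP and AN (from an axiom $\varphi$ of the system infer $\square\varphi$; only for axioms). $\Phi\vdash_{\mathcal L}\varphi$: there is a finite sequence ending in $\varphi$ whose members are axioms of $\mathcal L$, members of $\Phi$,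 instances of (TND), formulas $\square\psi$ with $\psi$ an axiom of $\mathcal L$, or obtained by MP from earlier members. $EL5^-$: axiom schemes (INT),(A1)–(A5),(KBel),(CoRe); $E4L5^-=EL5^-+$(E4); $E5L5^-=E4L5^-+$(E5); $E6L5^-=EL5^-+$(PNB)$+$(NNB); $EL5=EL5^-+$(IntRe); $EkL5=EkL5^-+$(IntRe). Frames. An $EL5^-$-frame is $\mathcal F=(W,R,P,E,w_T)$: $W$ nonempty; $R$ a partial order on $W$ with least element $w_\bot$ in which every chain has an upper bound; $R(w):=\{w': wRw'\}$; $Max(W)$ the set of $R$-maximal elements; $P$ a set of $R$-upward closed subsets of $W$; $E:W\to\mathcal P(P)$ with each $E(w)$ a filter on $P$ (nonempty, closed under $\cap$, upward closed in $P$) and $wRw'\Rightarrow E(w)\subseteq E(w')$; $w_T\in Max(W)$; $\varnothing,W\in P$ and $P$ closed under $\cap$, $\cup$, $A\supset B:=\{w:\forall w'\in R(w)(w'\in A\Rightarrow w'\in B)\}$, $KA:=\{w: A\in E(w)\}$. $E4L5^-$-frame: $A\in E(w)\Rightarrow\{w': A\in E(w')\}\in E(w)$. $E5L5^-$-frame: $E4L5^-$-frame such that if $A\notin E(w')$ for all $w'\in R(w)$ then $(\{w'': A\in E(w'')\}\supset\varnothing)\in E(w)$. $E6L5^-$-frame: $E(w)=E(w_\bot)$ for all $w$. An $EL5$-frame (resp. $EkL5$-frame) is an $EL5^-$-frame (resp. $EkL5^-$-frame) such that $Max(W)\cap R(w)\subseteq A$ for all $w\in W$ and $A\in E(w)$.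 Semantics. A relational model is $\mathcal K=(\mathcal F,g)$ with $g:V\to P$. Satisfaction: $w\nvDash\bot$; $w\vDash x$ iff $w\in g(x)$; $\vee,\wedge$ pointwise; $w\vDash\varphi\rightarrow\psi$ iff for all $w'\in R(w)$, $w'\vDash\varphi$ implies $w'\vDash\psi$; $w\vDash\square\varphi$ iff $w_\bot\vDash\varphi$; $w\vDash K\varphi$ iff $\varphi^*\in E(w)$ where $\varphi^*:=\{w': w'\vDash\varphi\}$. $\mathcal K\vDash\varphi$ iff $w_T\vDash\varphi$. $\Phi\Vdash^r_{\mathcal L}\psi$ iff every relational model based on an $\mathcal L$-frame in which all formulas of $\Phi$ are true also makes $\psi$ true. *)

theory Defs
  imports Main
begin

datatype 'v ifm =
    IVar 'v
  | IBot
  | IAnd "'v ifm" "'v ifm"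
  | IOr "'v ifm" "'v ifm"
  | IImp "'v ifm" "'v ifm"

inductive ipc_theorem :: "'v ifm \<Rightarrow> bool" where
  imp_k: "ipc_theorem (IImp a (IImp b a))"
| imp_s: "ipc_theorem (IImp (IImp a (IImp b c)) (IImp (IImp a b) (IImp a c)))"
| and_e1: "ipc_theorem (IImp (IAnd a b) a)"
| and_e2: "ipc_theorem (IImp (IAnd a b) b)"
| and_i: "ipc_theorem (IImp a (IImp b (IAnd a b)))"
| or_i1: "ipc_theorem (IImp a (IOr a b))"
| or_i2: "ipc_theorem (IImp b (IOr a b))"
| or_e: "ipc_theorem (IImp (IImp a c) (IImp (IImp b c) (IImp (IOr a b) c)))"
| bot_e: "ipc_theorem (IImp IBot a)"
| mp: "ipc_theorem (IImp a b) \<Longrightarrow> ipc_theorem a \<Longrightarrow> ipc_theorem b"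

datatype 'v fm =
    Var 'v
  | Bot (\<open>\<bottom>\<close>)
  | And "'v fm" "'v fm" (infixr \<open>\<^bold>\<and>\<close> 55)
  | Or "'v fm" "'v fm" (infixr \<open>\<^bold>\<or>\<close> 54)
  | Imp "'v fm" "'v fm" (infixr \<open>\<^bold>\<longrightarrow>\<close> 53)
  | Box "'v fm" (\<open>\<box> _\<close> [60] 60)
  | Know "'v fm" (\<open>\<^bold>K _\<close> [60] 60)

abbreviation Neg :: "'v fm \<Rightarrow> 'v fm" (\<open>\<^bold>\<not> _\<close> [60] 60)
  where "\<^bold>\<not> \<phi> \<equiv> \<phi> \<^bold>\<longrightarrow> \<bottom>"

primrec subst :: "('u \<Rightarrow> 'v fm) \<Rightarrow> 'u ifm \<Rightarrow> 'v fm" where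
  "subst \<sigma> (IVar x) = \<sigma> x"
| "subst \<sigma> IBot = \<bottom>"
| "subst \<sigma> (IAnd a b) = (subst \<sigma> a \<^bold>\<and> subst \<sigma> b)"
| "subst \<sigma> (IOr a b) = (subst \<sigma> a \<^bold>\<or> subst \<sigma> b)"
| "subst \<sigma> (IImp a b) = (subst \<sigma> a \<^bold>\<longrightarrow> subst \<sigma> b)"

text \<open>The theorems of intuitionistic logic themselves are the instances under \<open>\<sigma> = Var\<close>.\<close>

definition ax_INT :: "'v fm set" where
  "ax_INT = {subst \<sigma> a | (\<sigma> :: 'v \<Rightarrow> 'v fm) a. ipc_theorem a}"

definition ax_A1 :: "'v fm set" where
  "ax_A1 = {\<box> (\<phi> \<^bold>\<or> \<psi>) \<^bold>\<longrightarrow> (\<box> \<phi> \<^bold>\<or> \<box> \<psi>) | \<phi> \<psi>. True}"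

definition ax_A2 :: "'v fm set" where
  "ax_A2 = {\<box> \<phi> \<^bold>\<longrightarrow> \<phi> | \<phi>. True}"

definition ax_A3 :: "'v fm set" where
  "ax_A3 = {\<box> (\<phi> \<^bold>\<longrightarrow> \<psi>) \<^bold>\<longrightarrow> \<box> (\<box> \<phi> \<^bold>\<longrightarrow> \<box> \<psi>) | \<phi> \<psi>. True}"

definition ax_A4 :: "'v fm set" where
  "ax_A4 = {\<box> \<phi> \<^bold>\<longrightarrow> \<box> \<box> \<phi> | \<phi>. True}"

definition ax_A5 :: "'v fm set" where
  "ax_A5 = {\<^bold>\<not> \<box> \<phi> \<^bold>\<longrightarrow> \<box> \<^bold>\<not> \<box> \<phi> | \<phi>. True}"

definition ax_KBel :: "'v fm set" where
  "ax_KBel = {\<^bold>K (\<phi> \<^bold>\<longrightarrow> \<psi>) \<^bold>\<longrightarrow> (\<^bold>K \<phi> \<^bold>\<longrightarrow> \<^bold>K \<psi>) | \<phi> \<psi>. True}"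

definition ax_CoRe :: "'v fm set" where
  "ax_CoRe = {\<box> \<phi> \<^bold>\<longrightarrow> \<box> \<^bold>K \<phi> | \<phi>. True}"

definition ax_IntRe :: "'v fm set" where
  "ax_IntRe = {\<^bold>K \<phi> \<^bold>\<longrightarrow> \<^bold>\<not> \<^bold>\<not> \<phi> | \<phi>. True}"

definition ax_E4 :: "'v fm set" where
  "ax_E4 = {\<^bold>K \<phi> \<^bold>\<longrightarrow> \<^bold>K \<^bold>K \<phi> | \<phi>. True}"

definition ax_E5 :: "'v fm set" where
  "ax_E5 = {\<^bold>\<not> \<^bold>K \<phi> \<^bold>\<longrightarrow> \<^bold>K \<^bold>\<not> \<^bold>K \<phi> | \<phi>. True}"

definition ax_PNB :: "'v fm set" where
  "ax_PNB = {\<^bold>K \<phi> \<^bold>\<longrightarrow> \<box> \<^bold>K \<phi> | \<phi>. True}"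

definition ax_NNB :: "'v fm set" where
  "ax_NNB = {\<^bold>\<not> \<^bold>K \<phi> \<^bold>\<longrightarrow> \<box> \<^bold>\<not> \<^bold>K \<phi> | \<phi>. True}"

definition TND :: "'v fm set" where
  "TND = {\<phi> \<^bold>\<or> \<^bold>\<not> \<phi> | \<phi>. True}"

text \<open>\<open>Minus Plain\<close> is EL5$^-$ and \<open>Minus Ek\<close> is EkL5$^-$;
  \<open>Full Plain\<close> is EL5 and \<open>Full Ek\<close> is EkL5 (for k = 4, 5, 6).\<close>

datatype strength = Plain | E4 | E5 | E6

datatype el_logic = Minus strength | Full strength

definition axioms_EL5m :: "'v fm set" where
  "axioms_EL5m = ax_INT \<union> ax_A1 \<union> ax_A2 \<union> ax_A3 \<union> ax_A4 \<union> ax_A5 \<union> ax_KBel \<union> ax_CoRe"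

primrec axioms_minus :: "strength \<Rightarrow> 'v fm set" where
  "axioms_minus Plain = axioms_EL5m"
| "axioms_minus E4 = axioms_EL5m \<union> ax_E4"
| "axioms_minus E5 = axioms_EL5m \<union> ax_E4 \<union> ax_E5"
| "axioms_minus E6 = axioms_EL5m \<union> ax_PNB \<union> ax_NNB"

primrec axioms :: "el_logic \<Rightarrow> 'v fm set" where
  "axioms (Minus s) = axioms_minus s"
| "axioms (Full s) = axioms_minus s \<union> ax_IntRe"

definition is_derivation :: "el_logic \<Rightarrow> 'v fm set \<Rightarrow> 'v fm list \<Rightarrow> bool" where
  "is_derivation L \<Phi> \<chi>s \<longleftrightarrow>
    (\<forall>i < length \<chi>s.
        \<chi>s ! i \<in> axioms L \<or> \<chi>s ! i \<in> \<Phi> \<or> \<chi>s ! i \<in> TND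
      \<or> (\<exists>\<psi> \<in> axioms L. \<chi>s ! i = \<box> \<psi>)
      \<or> (\<exists>j < i. \<exists>k < i. \<chi>s ! k = (\<chi>s ! j \<^bold>\<longrightarrow> \<chi>s ! i)))"

definition derivable :: "'v fm set \<Rightarrow> el_logic \<Rightarrow> 'v fm \<Rightarrow> bool" (\<open>_ \<turnstile>\<^bsub>_\<^esub> _\<close> [51, 0, 51] 50) where
  "\<Phi> \<turnstile>\<^bsub>L\<^esub> \<phi> \<longleftrightarrow> (\<exists>\<chi>s. \<chi>s \<noteq> [] \<and> last \<chi>s = \<phi> \<and> is_derivation L \<Phi> \<chi>s)"

text \<open>The fields are \<open>W\<close>, \<open>R\<close>, \<open>P\<close>, \<open>E\<close>, \<open>w\<^sub>T\<close> in this order.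
  Values of \<open>ev\<close> outside \<open>worlds\<close> are irrelevant.\<close>

record 'w frame =
  worlds :: "'w set"
  acc :: "('w \<times> 'w) set"
  props :: "'w set set"
  ev :: "'w \<Rightarrow> 'w set set"
  wT :: 'w

definition up :: "'w frame \<Rightarrow> 'w \<Rightarrow> 'w set" where
  "up F w = {w' \<in> worlds F. (w, w') \<in> acc F}"

definition is_least :: "'w frame \<Rightarrow> 'w \<Rightarrow> bool" where
  "is_least F b \<longleftrightarrow> b \<in> worlds F \<and> (\<forall>w \<in> worlds F. (b, w) \<in> acc F)"

definition wbot :: "'w frame \<Rightarrow> 'w" where
  "wbot F = (THE b. is_least F b)"

definition Maxi :: "'w frame \<Rightarrow> 'w set" where
  "Maxi F = {m \<in> worlds F. \<forall>w \<in> worlds F. (m, w) \<in> acc F \<longrightarrow> w = m}"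

definition arrow :: "'w frame \<Rightarrow> 'w set \<Rightarrow> 'w set \<Rightarrow> 'w set" where
  "arrow F A B = {w \<in> worlds F. \<forall>w' \<in> up F w. w' \<in> A \<longrightarrow> w' \<in> B}"

definition knows :: "'w frame \<Rightarrow> 'w set \<Rightarrow> 'w set" where
  "knows F A = {w \<in> worlds F. A \<in> ev F w}"

definition upward_closed :: "'w frame \<Rightarrow> 'w set \<Rightarrow> bool" where
  "upward_closed F A \<longleftrightarrow> A \<subseteq> worlds F \<and> (\<forall>w \<in> A. up F w \<subseteq> A)"

text \<open>A filter on \<open>P\<close> need not be proper.\<close>

definition filter_on :: "'w set set \<Rightarrow> 'w set set \<Rightarrow> bool" where
  "filter_on \<P> \<F> \<longleftrightarrow> \<F> \<subseteq> \<P> \<and> \<F> \<noteq> {}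
    \<and> (\<forall>A \<in> \<F>. \<forall>B \<in> \<F>. A \<inter> B \<in> \<F>)
    \<and> (\<forall>A \<in> \<F>. \<forall>B \<in> \<P>. A \<subseteq> B \<longrightarrow> B \<in> \<F>)"

definition EL5m_frame :: "'w frame \<Rightarrow> bool" where
  "EL5m_frame F \<longleftrightarrow>
      worlds F \<noteq> {}
    \<and> partial_order_on (worlds F) (acc F)
    \<and> (\<exists>b. is_least F b)
    \<and> (\<forall>C \<in> Chains (acc F). \<exists>u \<in> worlds F. \<forall>c \<in> C. (c, u) \<in> acc F)
    \<and> (\<forall>A \<in> props F. upward_closed F A)
    \<and> (\<forall>w \<in> worlds F. filter_on (props F) (ev F w))
    \<and> (\<forall>w \<in> worlds F. \<forall>w' \<in> worlds F. (w, w') \<in> acc F \<longrightarrow> ev F w \<subseteq> ev F w')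
    \<and> wT F \<in> Maxi F
    \<and> {} \<in> props F \<and> worlds F \<in> props F
    \<and> (\<forall>A \<in> props F. \<forall>B \<in> props F. A \<inter> B \<in> props F \<and> A \<union> B \<in> props F \<and> arrow F A B \<in> props F)
    \<and> (\<forall>A \<in> props F. knows F A \<in> props F)"

definition E4L5m_frame :: "'w frame \<Rightarrow> bool" where
  "E4L5m_frame F \<longleftrightarrow> EL5m_frame F \<and>
    (\<forall>w \<in> worlds F. \<forall>A \<in> ev F w. knows F A \<in> ev F w)"

definition E5L5m_frame :: "'w frame \<Rightarrow> bool" where
  "E5L5m_frame F \<longleftrightarrow> E4L5m_frame F \<and>
    (\<forall>w \<in> worlds F. \<forall>A \<in> props F. (\<forall>w' \<in> up F w. A \<notin> ev F w') \<longrightarrow> arrow F (knows F A) {} \<in> ev F w)"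

definition E6L5m_frame :: "'w frame \<Rightarrow> bool" where
  "E6L5m_frame F \<longleftrightarrow> EL5m_frame F \<and> (\<forall>w \<in> worlds F. ev F w = ev F (wbot F))"

primrec frame_minus :: "strength \<Rightarrow> 'w frame \<Rightarrow> bool" where
  "frame_minus Plain F = EL5m_frame F"
| "frame_minus E4 F = E4L5m_frame F"
| "frame_minus E5 F = E5L5m_frame F"
| "frame_minus E6 F = E6L5m_frame F"

primrec frame_for :: "el_logic \<Rightarrow> 'w frame \<Rightarrow> bool" where
  "frame_for (Minus s) F = frame_minus s F"
| "frame_for (Full s) F =
    (frame_minus s F \<and> (\<forall>w \<in> worlds F. \<forall>A \<in> ev F w. Maxi F \<inter> up F w \<subseteq> A))"

primrec sat :: "'w frame \<Rightarrow> ('v \<Rightarrow> 'w set) \<Rightarrow> 'w \<Rightarrow> 'v fm \<Rightarrow> bool" where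
  "sat F g w (Var x) \<longleftrightarrow> w \<in> g x"
| "sat F g w \<bottom> \<longleftrightarrow> False"
| "sat F g w (\<phi> \<^bold>\<and> \<psi>) \<longleftrightarrow> sat F g w \<phi> \<and> sat F g w \<psi>"
| "sat F g w (\<phi> \<^bold>\<or> \<psi>) \<longleftrightarrow> sat F g w \<phi> \<or> sat F g w \<psi>"
| "sat F g w (\<phi> \<^bold>\<longrightarrow> \<psi>) \<longleftrightarrow> (\<forall>w' \<in> up F w. sat F g w' \<phi> \<longrightarrow> sat F g w' \<psi>)"
| "sat F g w (\<box> \<phi>) \<longleftrightarrow> sat F g (wbot F) \<phi>"
| "sat F g w (\<^bold>K \<phi>) \<longleftrightarrow> {w' \<in> worlds F. sat F g w' \<phi>} \<in> ev F w"

definition true_in :: "'w frame \<Rightarrow> ('v \<Rightarrow> 'w set) \<Rightarrow> 'v fm \<Rightarrow> bool" where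
  "true_in F g \<phi> \<longleftrightarrow> sat F g (wT F) \<phi>"

text \<open>HOL cannot quantify over types inside a formula, so the type of worlds is a parameter.
  A statement about \<open>rel_conseq TYPE('w)\<close> with \<open>'w\<close> a type variable covers models of all sizes.\<close>

definition rel_conseq :: "'w itself \<Rightarrow> el_logic \<Rightarrow> 'v fm set \<Rightarrow> 'v fm \<Rightarrow> bool" where
  "rel_conseq _ L \<Phi> \<psi> \<longleftrightarrow>
    (\<forall>(F :: 'w frame) g. frame_for L F \<longrightarrow> range g \<subseteq> props F \<longrightarrow>
      (\<forall>\<phi> \<in> \<Phi>. true_in F g \<phi>) \<longrightarrow> true_in F g \<psi>)"

end

theory Submission
  imports Defs
begin

text \<open>Every axiom holds at all worlds of every model based on a frame for the logic, hence also at
  the least world, so its necessitation is true as well. Instances of TND and modus ponens are only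
  needed at the designated world, where the maximality of that world makes implication classical.\<close>

locale el_model =
  fixes F :: "'w frame" and g :: "'v \<Rightarrow> 'w set"
  assumes frame: "EL5m_frame F" and val: "range g \<subseteq> props F"
begin

abbreviation truth_set :: "'v fm \<Rightarrow> 'w set" where
  "truth_set \<phi> \<equiv> {w \<in> worlds F. sat F g w \<phi>}"

section \<open>Order, least world, designated world and filters\<close>

lemma acc_refl: "w \<in> worlds F \<Longrightarrow> (w, w) \<in> acc F"
  using frame unfolding EL5m_frame_def partial_order_on_def preorder_on_def refl_on_def by blast

lemma acc_trans: "(u, v) \<in> acc F \<Longrightarrow> (v, w) \<in> acc F \<Longrightarrow> (u, w) \<in> acc F"
  using frame unfolding EL5m_frame_def partial_order_on_def preorder_on_def trans_def by blast

lemma acc_antisym: "(u, v) \<in> acc F \<Longrightarrow> (v, u) \<in> acc F \<Longrightarrow> u = v"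
  using frame unfolding EL5m_frame_def partial_order_on_def antisym_def by blast

lemma up_self: "w \<in> worlds F \<Longrightarrow> w \<in> up F w"
  by (simp add: up_def acc_refl)

lemma up_trans: "v \<in> up F u \<Longrightarrow> w \<in> up F v \<Longrightarrow> w \<in> up F u"
  unfolding up_def using acc_trans by blast

lemma up_worlds: "v \<in> up F u \<Longrightarrow> v \<in> worlds F"
  by (simp add: up_def)

text \<open>Antisymmetry makes the least world unique, so the definite description behind
  \<open>wbot\<close> really denotes it.\<close>

lemma is_least_wbot: "is_least F (wbot F)"
proof -
  obtain b where b: "is_least F b"
    using frame unfolding EL5m_frame_def by blast
  then have "c = b" if "is_least F c" for c
    using that acc_antisym unfolding is_least_def by blast
  then show ?thesis
    unfolding wbot_def using b by (metis theI)
qed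

lemma wbot_worlds: "wbot F \<in> worlds F"
  using is_least_wbot unfolding is_least_def by blast

lemma up_wbot: "w \<in> worlds F \<Longrightarrow> w \<in> up F (wbot F)"
  using is_least_wbot unfolding is_least_def up_def by blast

lemma wT_worlds: "wT F \<in> worlds F"
  using frame unfolding EL5m_frame_def Maxi_def by blast

lemma up_wT: "up F (wT F) = {wT F}"
  using frame acc_refl unfolding EL5m_frame_def Maxi_def up_def by blast

lemma filter_ev: "w \<in> worlds F \<Longrightarrow> filter_on (props F) (ev F w)"
  using frame unfolding EL5m_frame_def by blast

lemma ev_mono: "w \<in> worlds F \<Longrightarrow> w' \<in> up F w \<Longrightarrow> A \<in> ev F w \<Longrightarrow> A \<in> ev F w'"
  using frame unfolding EL5m_frame_def up_def by blast

lemma props_upward_closed: "A \<in> props F \<Longrightarrow> upward_closed F A"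
  using frame unfolding EL5m_frame_def by blast

lemma props_closed:
  "{} \<in> props F" "worlds F \<in> props F"
  "A \<in> props F \<Longrightarrow> B \<in> props F \<Longrightarrow> A \<inter> B \<in> props F"
  "A \<in> props F \<Longrightarrow> B \<in> props F \<Longrightarrow> A \<union> B \<in> props F"
  "A \<in> props F \<Longrightarrow> B \<in> props F \<Longrightarrow> arrow F A B \<in> props F"
  "A \<in> props F \<Longrightarrow> knows F A \<in> props F"
  using frame unfolding EL5m_frame_def by blast+

section \<open>Truth sets as propositions, and persistence\<close>

lemma truth_set_simps:
  "truth_set \<bottom> = {}"
  "truth_set (\<phi> \<^bold>\<and> \<psi>) = truth_set \<phi> \<inter> truth_set \<psi>"
  "truth_set (\<phi> \<^bold>\<or> \<psi>) = truth_set \<phi> \<union> truth_set \<psi>"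
  "truth_set (\<phi> \<^bold>\<longrightarrow> \<psi>) = arrow F (truth_set \<phi>) (truth_set \<psi>)"
  "truth_set (\<box> \<phi>) = (if sat F g (wbot F) \<phi> then worlds F else {})"
  "truth_set (\<^bold>K \<phi>) = knows F (truth_set \<phi>)"
  by (auto simp: arrow_def knows_def up_def)

text \<open>By \<open>truth_set_simps\<close> each connective acts on truth sets as an operation
  under which \<open>props F\<close> is closed. Upward closure in a filter \<open>ev F w\<close>
  speaks only of members of \<open>props F\<close>, so its use on truth sets rests on this
  lemma.\<close>

lemma truth_set_props: "truth_set \<phi> \<in> props F"
proof (induction \<phi>)
  case (Var x)
  have "g x \<in> props F" using val by blast
  moreover from this have "truth_set (Var x) = g x"
    using props_upward_closed unfolding upward_closed_def by auto
  ultimately show ?case by simp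
next
  \<comment> \<open>The truth value of a boxed formula is the same at all worlds, so its truth set
    is either empty or everything.\<close>
  case (Box \<phi>)
  then show ?case unfolding truth_set_simps using props_closed(1,2) by simp
qed (simp_all only: truth_set_simps props_closed)

text \<open>Persistence comes for free once truth sets are propositions, since these are upward
  closed.\<close>

lemma sat_mono: "w \<in> worlds F \<Longrightarrow> w' \<in> up F w \<Longrightarrow> sat F g w \<phi> \<Longrightarrow> sat F g w' \<phi>"
  using props_upward_closed[OF truth_set_props[of \<phi>]] unfolding upward_closed_def by blast

lemma sat_wbot: "sat F g (wbot F) \<phi> \<Longrightarrow> w \<in> worlds F \<Longrightarrow> sat F g w \<phi>"
  using sat_mono wbot_worlds up_wbot by blast

lemma ev_inter: "w \<in> worlds F \<Longrightarrow> A \<in> ev F w \<Longrightarrow> B \<in> ev F w \<Longrightarrow> A \<inter> B \<in> ev F w"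
  using filter_ev unfolding filter_on_def by blast

lemma ev_superset: "w \<in> worlds F \<Longrightarrow> A \<in> ev F w \<Longrightarrow> A \<subseteq> B \<Longrightarrow> B \<in> props F \<Longrightarrow> B \<in> ev F w"
  using filter_ev unfolding filter_on_def by blast

lemma worlds_ev:
  assumes "w \<in> worlds F"
  shows "worlds F \<in> ev F w"
proof -
  obtain A where "A \<in> ev F w" "A \<in> props F"
    using filter_ev[OF assms] unfolding filter_on_def by (meson equals0I subsetD)
  then show ?thesis
    using ev_superset[OF assms] props_upward_closed props_closed(2)
    unfolding upward_closed_def by blast
qed

text \<open>Zorn's lemma for the order restricted to the cone \<open>up F w\<close>. It supplies the
  maximal worlds on which the frame condition for IntRe speaks.\<close>

lemma Maxi_above:
  assumes w: "w \<in> worlds F"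
  shows "\<exists>m \<in> Maxi F. m \<in> up F w"
proof -
  define r where "r = acc F \<inter> up F w \<times> up F w"
  have field: "Field r = up F w"
    unfolding r_def Field_def using acc_refl up_worlds by blast
  have "Partial_order r"
    unfolding field unfolding partial_order_on_def preorder_on_def
      refl_on_def trans_def antisym_def r_def
    using acc_refl acc_trans acc_antisym up_worlds by blast
  moreover have "\<exists>u \<in> Field r. \<forall>c \<in> C. (c, u) \<in> r" if C: "C \<in> Chains r" for C
  \<comment> \<open>The bound that the frame gives for the empty chain may lie outside the cone, so
    \<open>w\<close> itself is taken there. A nonempty chain has a member between \<open>w\<close>
    and its bound, which puts the bound into the cone.\<close>
  proof (cases "C = {}")
    case True
    then show ?thesis using field up_self[OF w] by blast
  next
    case False
    have CU: "C \<subseteq> up F w" using C unfolding Chains_def r_def by blast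
    have "C \<in> Chains (acc F)" using C unfolding Chains_def r_def by blast
    then obtain u where u: "u \<in> worlds F" "\<forall>c \<in> C. (c, u) \<in> acc F"
      using frame unfolding EL5m_frame_def by blast
    have "u \<in> up F w"
      using False CU u acc_trans unfolding up_def by blast
    then show ?thesis
      using CU u field unfolding r_def by blast
  qed
  ultimately obtain m where m: "m \<in> Field r" "\<forall>a \<in> Field r. (m, a) \<in> r \<longrightarrow> a = m"
    using Zorns_po_lemma[of r] by blast
  have "a = m" if "a \<in> worlds F" "(m, a) \<in> acc F" for a
  proof -
    have "a \<in> up F w"
      using up_trans[of m w a] that m(1) field unfolding up_def by blast
    then show ?thesis using m that field unfolding r_def by blast
  qed
  then have "m \<in> Maxi F"
    using m(1) field up_worlds unfolding Maxi_def by blast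
  then show ?thesis using m field by blast
qed

section \<open>Validity of the axioms at every world\<close>

lemma sat_subst_ipc_theorem:
  assumes "ipc_theorem a" "w \<in> worlds F"
  shows "sat F g w (subst \<sigma> a)"
  using assms
proof (induction arbitrary: w rule: ipc_theorem.induct)
  case imp_s
  then show ?case by simp (meson up_self up_trans up_worlds)
next
  case or_e
  then show ?case by simp (meson up_trans up_worlds)
next
  case (mp a b)
  then show ?case using up_self by auto
next
  \<comment> \<open>Here and in \<open>and_i\<close> a formula assumed at one world is used at a
    later one, which is persistence.\<close>
  case imp_k
  then show ?case by simp (meson sat_mono up_worlds)
next
  case and_i
  then show ?case by simp (meson sat_mono up_worlds)
qed simp_all

lemma sat_axioms_EL5m:
  assumes "\<phi> \<in> axioms_EL5m" "w \<in> worlds F"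
  shows "sat F g w \<phi>"
proof -
  have KBel: "sat F g w (\<^bold>K (\<alpha> \<^bold>\<longrightarrow> \<beta>) \<^bold>\<longrightarrow> (\<^bold>K \<alpha> \<^bold>\<longrightarrow> \<^bold>K \<beta>))" for \<alpha> \<beta>
  proof -
    have "truth_set \<beta> \<in> ev F v"
      if u: "u \<in> up F w" and v: "v \<in> up F u"
        and imp: "truth_set (\<alpha> \<^bold>\<longrightarrow> \<beta>) \<in> ev F u" and ante: "truth_set \<alpha> \<in> ev F v" for u v
    proof -
      have vW: "v \<in> worlds F" using v by (rule up_worlds)
      \<comment> \<open>The known implication was assumed at \<open>u\<close>, its known antecedent
        only at the later world \<open>v\<close>. Monotonicity of \<open>ev\<close> brings both into
        the same filter; the intersection lies below the consequent because implication at a world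
        includes that world.\<close>
      have "truth_set (\<alpha> \<^bold>\<longrightarrow> \<beta>) \<inter> truth_set \<alpha> \<in> ev F v"
        using ev_inter[OF vW] ev_mono[OF up_worlds[OF u] v imp] ante by blast
      moreover have "truth_set (\<alpha> \<^bold>\<longrightarrow> \<beta>) \<inter> truth_set \<alpha> \<subseteq> truth_set \<beta>"
        using up_self by auto
      ultimately show ?thesis using ev_superset[OF vW] truth_set_props by blast
    qed
    then show ?thesis by simp
  qed
  have CoRe: "sat F g w (\<box> \<alpha> \<^bold>\<longrightarrow> \<box> \<^bold>K \<alpha>)" for \<alpha>
  proof -
    \<comment> \<open>Truth at the least world spreads to all worlds, and the set of all worlds
      belongs to every filter.\<close>
    have "truth_set \<alpha> = worlds F" if "sat F g (wbot F) \<alpha>"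
      using sat_wbot[OF that] by blast
    then show ?thesis using worlds_ev[OF wbot_worlds] by simp
  qed
  have "sat F g w (\<box> (\<alpha> \<^bold>\<or> \<beta>) \<^bold>\<longrightarrow> (\<box> \<alpha> \<^bold>\<or> \<box> \<beta>))" for \<alpha> \<beta>
    by simp
  moreover have "sat F g w (\<box> \<alpha> \<^bold>\<longrightarrow> \<alpha>)" for \<alpha>
    using sat_wbot up_worlds by auto
  moreover have "sat F g w (\<box> (\<alpha> \<^bold>\<longrightarrow> \<beta>) \<^bold>\<longrightarrow> \<box> (\<box> \<alpha> \<^bold>\<longrightarrow> \<box> \<beta>))" for \<alpha> \<beta>
    using up_self[OF wbot_worlds] by auto
  \<comment> \<open>Reflexivity turns a negated box at any world into failure of \<alpha> at
    \<open>wbot F\<close>, so the box fails at every world.\<close>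
  moreover have "sat F g w (\<^bold>\<not> \<box> \<alpha> \<^bold>\<longrightarrow> \<box> \<^bold>\<not> \<box> \<alpha>)" for \<alpha>
    using up_self up_worlds by fastforce
  moreover have "sat F g w (\<box> \<alpha> \<^bold>\<longrightarrow> \<box> \<box> \<alpha>)" for \<alpha>
    by simp
  ultimately show ?thesis
    using assms KBel CoRe sat_subst_ipc_theorem
    unfolding axioms_EL5m_def ax_INT_def ax_A1_def ax_A2_def ax_A3_def ax_A4_def ax_A5_def
      ax_KBel_def ax_CoRe_def
    by blast
qed

lemma sat_E4:
  assumes "E4L5m_frame F" "w \<in> worlds F"
  shows "sat F g w (\<^bold>K \<alpha> \<^bold>\<longrightarrow> \<^bold>K \<^bold>K \<alpha>)"
proof -
  have "truth_set (\<^bold>K \<alpha>) \<in> ev F u" if "u \<in> worlds F" "truth_set \<alpha> \<in> ev F u" for u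
    using assms that unfolding E4L5m_frame_def truth_set_simps by blast
  then show ?thesis using up_worlds by simp
qed

text \<open>The antecedent says that no world above knows \<open>truth_set \<alpha>\<close>. This is
  the premise of the frame condition, whose conclusion is about the truth set of the negated
  knowledge formula.\<close>

lemma sat_E5:
  assumes "E5L5m_frame F" "w \<in> worlds F"
  shows "sat F g w (\<^bold>\<not> \<^bold>K \<alpha> \<^bold>\<longrightarrow> \<^bold>K \<^bold>\<not> \<^bold>K \<alpha>)"
proof -
  have "truth_set (\<^bold>\<not> \<^bold>K \<alpha>) \<in> ev F u"
    if "u \<in> worlds F" "\<forall>v \<in> up F u. truth_set \<alpha> \<notin> ev F v" for u
    using assms that truth_set_props unfolding E5L5m_frame_def truth_set_simps by blast
  then show ?thesis using up_worlds by simp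
qed

text \<open>With \<open>ev\<close> constant, the truth value of a knowledge formula does not depend
  on the world, just as for a boxed formula.\<close>

lemma sat_PNB_NNB:
  assumes "E6L5m_frame F" "w \<in> worlds F"
  shows "sat F g w (\<^bold>K \<alpha> \<^bold>\<longrightarrow> \<box> \<^bold>K \<alpha>)" "sat F g w (\<^bold>\<not> \<^bold>K \<alpha> \<^bold>\<longrightarrow> \<box> \<^bold>\<not> \<^bold>K \<alpha>)"
proof -
  have ev: "truth_set \<alpha> \<in> ev F u \<longleftrightarrow> truth_set \<alpha> \<in> ev F (wbot F)" if "u \<in> worlds F" for u
    using assms that unfolding E6L5m_frame_def by blast
  show "sat F g w (\<^bold>K \<alpha> \<^bold>\<longrightarrow> \<box> \<^bold>K \<alpha>)"
    unfolding sat.simps using ev up_worlds by blast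
  show "sat F g w (\<^bold>\<not> \<^bold>K \<alpha> \<^bold>\<longrightarrow> \<box> \<^bold>\<not> \<^bold>K \<alpha>)"
    unfolding sat.simps using ev up_worlds up_self by blast
qed

lemma sat_IntRe:
  assumes "\<forall>w \<in> worlds F. \<forall>A \<in> ev F w. Maxi F \<inter> up F w \<subseteq> A" "w \<in> worlds F"
  shows "sat F g w (\<^bold>K \<alpha> \<^bold>\<longrightarrow> \<^bold>\<not> \<^bold>\<not> \<alpha>)"
proof -
  \<comment> \<open>A maximal world above \<open>v\<close> is also above \<open>u\<close>, so every
    proposition known at \<open>u\<close> holds there. Hence no \<open>v\<close> above
    \<open>u\<close> satisfies the negation of \<alpha>.\<close>
  have "\<exists>m \<in> up F v. sat F g m \<alpha>"
    if u: "u \<in> worlds F" and A: "truth_set \<alpha> \<in> ev F u" and v: "v \<in> up F u" for u v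
  proof -
    obtain m where m: "m \<in> Maxi F" "m \<in> up F v"
      using Maxi_above[OF up_worlds[OF v]] by blast
    have "m \<in> up F u" using v m(2) by (rule up_trans)
    moreover have "Maxi F \<inter> up F u \<subseteq> truth_set \<alpha>"
      by (rule bspec[OF bspec[OF assms(1) u] A])
    ultimately show ?thesis using m by blast
  qed
  then show ?thesis using up_worlds by simp metis
qed

lemma sat_axioms:
  assumes frm: "frame_for L F" and ax: "\<phi> \<in> axioms L" and w: "w \<in> worlds F"
  shows "sat F g w \<phi>"
proof -
  \<comment> \<open>Proved for any \<open>s\<close>, to serve both \<open>Minus s\<close> and
    \<open>Full s\<close>, which adds only IntRe.\<close>
  have minus: "sat F g w \<phi>" if "frame_minus s F" "\<phi> \<in> axioms_minus s" for s
  proof (cases s)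
    case Plain
    then show ?thesis using that w sat_axioms_EL5m by simp
  next
    case E4
    then show ?thesis
      using that w sat_axioms_EL5m sat_E4
      unfolding ax_E4_def \<open>s = E4\<close> axioms_minus.simps frame_minus.simps by blast
  next
    case E5
    then have "E5L5m_frame F" using that by simp
    moreover from this have "E4L5m_frame F" unfolding E5L5m_frame_def by (rule conjunct1)
    ultimately show ?thesis
      using that w sat_axioms_EL5m sat_E4 sat_E5
      unfolding ax_E4_def ax_E5_def \<open>s = E5\<close> axioms_minus.simps by blast
  next
    case E6
    then show ?thesis
      using that w sat_axioms_EL5m sat_PNB_NNB
      unfolding ax_PNB_def ax_NNB_def \<open>s = E6\<close> axioms_minus.simps frame_minus.simps by blast
  qed
  show ?thesis
  proof (cases L)
    case (Minus s)
    then show ?thesis using minus frm ax by simp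
  next
    case (Full s)
    then show ?thesis
      using minus frm ax w sat_IntRe
      unfolding ax_IntRe_def \<open>L = Full s\<close> axioms.simps frame_for.simps by blast
  qed
qed

section \<open>Truth of derivations at the designated world\<close>

lemma derivation_true:
  assumes frm: "frame_for L F" and \<Phi>: "\<forall>\<phi> \<in> \<Phi>. true_in F g \<phi>"
    and der: "is_derivation L \<Phi> \<chi>s" and "i < length \<chi>s"
  shows "true_in F g (\<chi>s ! i)"
  using \<open>i < length \<chi>s\<close>
proof (induction i rule: less_induct)
  case (less i)
  from der less.prems consider
      "\<chi>s ! i \<in> axioms L" | "\<chi>s ! i \<in> \<Phi>" | "\<chi>s ! i \<in> TND"
    | \<psi> where "\<psi> \<in> axioms L" "\<chi>s ! i = \<box> \<psi>"
    | j k where "j < i" "k < i" "\<chi>s ! k = (\<chi>s ! j \<^bold>\<longrightarrow> \<chi>s ! i)"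
    unfolding is_derivation_def by blast
  then show ?case
  proof cases
    case 1
    then show ?thesis using sat_axioms[OF frm] wT_worlds unfolding true_in_def by blast
  next
    case 2
    then show ?thesis using \<Phi> by blast
  next
    case 3
    then show ?thesis unfolding TND_def true_in_def using up_wT by auto
  next
    \<comment> \<open>A box at \<open>wT F\<close> asks for its axiom at \<open>wbot F\<close>, so
      validity of the axioms beyond the designated world is used.\<close>
    case 4
    then show ?thesis using sat_axioms[OF frm] wbot_worlds unfolding true_in_def by simp
  next
    case (5 j k)
    then have "true_in F g (\<chi>s ! j)" "true_in F g (\<chi>s ! j \<^bold>\<longrightarrow> \<chi>s ! i)"
      using less.IH[of j] less.IH[of k] less.prems by simp_all
    then show ?thesis unfolding true_in_def using up_wT by simp
  qed
qed

end

lemma frame_for_EL5m: "frame_for L F \<Longrightarrow> EL5m_frame F"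
proof -
  have "frame_minus s F \<Longrightarrow> EL5m_frame F" for s
    by (cases s) (simp_all add: E4L5m_frame_def E5L5m_frame_def E6L5m_frame_def)
  then show "frame_for L F \<Longrightarrow> EL5m_frame F"
    by (cases L) auto
qed

theorem theorem4p6:
  fixes L :: el_logic and \<Phi> :: "'v fm set" and \<phi> :: "'v fm"
  assumes "infinite (UNIV :: 'v set)"
    and "\<Phi> \<turnstile>\<^bsub>L\<^esub> \<phi>"
  shows "rel_conseq TYPE('w) L \<Phi> \<phi>"
  unfolding rel_conseq_def
proof (intro allI impI)
  fix F :: "'w frame" and g
  assume frm: "frame_for L F" and "range g \<subseteq> props F" and \<Phi>: "\<forall>\<phi> \<in> \<Phi>. true_in F g \<phi>"
  then interpret el_model F g
    by unfold_locales (rule frame_for_EL5m)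
  obtain \<chi>s where "\<chi>s \<noteq> []" "last \<chi>s = \<phi>" "is_derivation L \<Phi> \<chi>s"
    using assms(2) unfolding derivable_def by blast
  then show "true_in F g \<phi>"
    \<comment> \<open>The derived formula sits at the last position, a legal index because the
      derivation is nonempty.\<close>
    using derivation_true[OF frm \<Phi>, of \<chi>s "length \<chi>s - 1"] by (simp add: last_conv_nth)
qed

end
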